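(* Let $\mathfrak{O}$ be the valuation ring of a non-Archimedean local field $K$ with $\mathrm{char}(K)\neq 2$, and let $q$ be its residue field size. Then $$\mathsf{Z}_{\mathfrak{so}_d(\mathfrak{O})}(T) = \mathsf{Z}_{\mathrm{M}_{d\times(d-1)}(\mathfrak{O})}(T) = \frac{1-q^{1-d}T}{(1-T)(1-qT)}.$$
   Context: $\mathfrak{so}_d(\mathfrak{O})=\{a\in\mathrm{M}_d(\mathfrak{O}): a+a^\top=0\}$. The residue characteristic is allowed to be $2$. Let $\mathfrak{P}$ be the maximal ideal of $\mathfrak{O}$ and $\mathfrak{O}_n=\mathfrak{O}/\mathfrak{P}^n$. For an $\mathfrak{O}$-submodule $M\subset\mathrm{M}_{d\times e}(\mathfrak{O})$, let $M_n$ be its image in $\mathrm{M}_{d\times e}(\mathfrak{O}_n)$ under entrywise reduction. The ask zeta function of $M$ is $\mathsf{Z}_M(T)=\sum_{n=0}^\infty \bigl(|M_n|^{-1}\sum_{a\in M_n}|\mathrm{Ker}(a)|\bigr)T^n$, where $\mathrm{Ker}(a)=\{x\in\mathfrak{O}_n^d: xa=0\}$ (row vectors). *)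

theory Defs
  imports
    "HOL-Analysis.Abstract_Metric_Spaces"
    "HOL-Algebra.QuotRing"
    "HOL-Algebra.Ideal_Product"
    "HOL-Computational_Algebra.Formal_Power_Series"
    "Jordan_Normal_Form.Matrix"
begin

unbundle no vec_syntax
unbundle no fps_syntax

text \<open>The field \<open>K\<close> is the whole type \<open>'a\<close>, and \<open>av\<close> is its absolute value.\<close>

definition valuation_ring :: "('a::field \<Rightarrow> real) \<Rightarrow> 'a ring" where
  "valuation_ring av =
     \<lparr>carrier = {x. av x \<le> 1}, monoid.mult = (*), one = 1, zero = 0, add = (+)\<rparr>"

definition valuation_ideal :: "('a::field \<Rightarrow> real) \<Rightarrow> 'a set" where
  "valuation_ideal av = {x. av x < 1}"

abbreviation residue_field :: "('a::field \<Rightarrow> real) \<Rightarrow> 'a set ring" where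
  "residue_field av \<equiv> valuation_ring av Quot valuation_ideal av"

text \<open>
  A non-Archimedean local field: a field that is complete with respect to a (nontrivial)
  discrete valuation and has finite residue field. Axiom \<open>discrete\<close> says that the value
  group is infinite cyclic; the absolute value need not be normalised.
\<close>

locale nonarch_local_field =
  fixes av :: "'a::field \<Rightarrow> real"
  assumes nonneg: "0 \<le> av x"
    and eq_zero_iff: "av x = 0 \<longleftrightarrow> x = 0"
    and multiplicative: "av (x * y) = av x * av y"
    and ultrametric: "av (x + y) \<le> max (av x) (av y)"
    and discrete: "\<exists>c. 0 < c \<and> c < 1 \<and> av ` (- {0}) = range (\<lambda>k::int. c powi k)"
    and complete: "Metric_space.mcomplete UNIV (\<lambda>x y. av (x - y))"
    and finite_residue_field: "finite (carrier (residue_field av))"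

text \<open>\<open>matrices_over R d e\<close> is $\mathrm{M}_{d \times e}(R)$.\<close>

definition matrices_over :: "('a, 'b) ring_scheme \<Rightarrow> nat \<Rightarrow> nat \<Rightarrow> 'a mat set" where
  "matrices_over R d e = {A \<in> carrier_mat d e. elements_mat A \<subseteq> carrier R}"

text \<open>
  The operations of \<open>valuation_ring av\<close> are those of the type \<open>'a\<close>, so matrix addition
  over the type is matrix addition over the valuation ring.
\<close>

definition so_matrices :: "('a::field \<Rightarrow> real) \<Rightarrow> nat \<Rightarrow> 'a mat set" where
  "so_matrices av d =
     {A \<in> matrices_over (valuation_ring av) d d. A + transpose_mat A = 0\<^sub>m d d}"

definition row_kernel :: "('a, 'b) ring_scheme \<Rightarrow> 'a mat \<Rightarrow> 'a vec set" where
  "row_kernel R A =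
     {x \<in> carrier_vec (dim_row A). set\<^sub>v x \<subseteq> carrier R \<and>
        (\<forall>j<dim_col A. (\<Oplus>\<^bsub>R\<^esub>i\<in>{..<dim_row A}. (x $ i) \<otimes>\<^bsub>R\<^esub> (A $$ (i, j))) = \<zero>\<^bsub>R\<^esub>)}"

text \<open>The power is the one for products of ideals; its zeroth power is the whole ring.\<close>

definition ideal_power :: "('a::field \<Rightarrow> real) \<Rightarrow> nat \<Rightarrow> 'a set" where
  "ideal_power av n = valuation_ideal av [^]\<^bsub>ideals_set (valuation_ring av)\<^esub> n"

definition reduction :: "('a::field \<Rightarrow> real) \<Rightarrow> nat \<Rightarrow> 'a mat set \<Rightarrow> 'a set mat set" where
  "reduction av n M =
     map_mat (\<lambda>x. ideal_power av n +>\<^bsub>valuation_ring av\<^esub> x) ` M"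

definition ask_zeta :: "('a::field \<Rightarrow> real) \<Rightarrow> 'a mat set \<Rightarrow> rat fps" where
  "ask_zeta av M = Abs_fps (\<lambda>n.
     (\<Sum>A\<in>reduction av n M.
        of_nat (card (row_kernel (valuation_ring av Quot ideal_power av n) A)))
     / of_nat (card (reduction av n M)))"

end

theory Submission
  imports Defs
begin

text \<open>
  Write \<open>R\<close> for \<open>\<O>/\<PP>^n\<close>, a finite ring of order \<open>q^n\<close> whose ideals form the chain
  \<open>I\<^sub>0 \<supset> I\<^sub>1 \<supset> \<dots> \<supset> I\<^sub>n = 0\<close>, and \<open>S\<close> for the image of the module of matrices over \<open>R\<close>.
  Counting the pairs \<open>(x, A)\<close> with \<open>x A = 0\<close> row vector by row vector turns the average of
  \<open>|Ker A|\<close> over \<open>S\<close> into the sum over \<open>x\<close> of the proportion of \<open>A\<close> in \<open>S\<close> with \<open>x A = 0\<close>.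

  Ideals being totally ordered, some entry \<open>a = x\<^sub>p\<close> divides all the others, so \<open>x = a c\<close> with
  \<open>c\<^sub>p = 1\<close>. When \<open>S\<close> consists of all \<open>d \<times> (d - 1)\<close> matrices, the map \<open>A \<mapsto> c A\<close> takes every value
  in \<open>R^(d-1)\<close> equally often, because adding \<open>\<delta>\<close> to row \<open>p\<close> of \<open>A\<close> adds \<open>\<delta>\<close> to \<open>c A\<close>. When \<open>S\<close> consists
  of the alternating \<open>d \<times> d\<close> matrices, the same holds for the \<open>d - 1\<close> entries of \<open>c A\<close> off position
  \<open>p\<close>, by changing row and column \<open>p\<close> together, and then \<open>c A c\<^sup>T = 0\<close> makes the equation
  at \<open>p\<close> a consequence of the others. In both cases \<open>x A = a (c A)\<close> vanishes for a proportion
  \<open>(|Ann a| / |R|)^(d-1)\<close> of the matrices (\<open>pivot_equidistributed_all\<close>,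
  \<open>pivot_equidistributed_alternating\<close>). This is why the two zeta functions agree.

  If \<open>x\<close> has entries in \<open>I\<^sub>k\<close> but not all in \<open>I\<^sub>k\<^sub>+\<^sub>1\<close>, then \<open>|Ann a| = q^k\<close>, and with \<open>m = n - k\<close> there are
  \<open>q^(m d) - q^((m-1) d)\<close> such vectors, contributing \<open>q^m - q^(m-d)\<close> in all; the zero vector contributes \<open>1\<close>. Hence the average
  is \<open>1 + \<Sum>\<^sub>1\<^sub>\<le>\<^sub>m\<^sub>\<le>\<^sub>n (q^m - q^(m-d))\<close> (\<open>average_kernel_size\<close>), and the generating function of these
  numbers is the stated rational function (\<open>fps_geometric_quotient\<close>).

  The characteristic of \<open>K\<close> enters once: as \<open>2 \<noteq> 0\<close> in \<open>K\<close>, skew-symmetric matrices over \<open>\<O>\<close> have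
  zero diagonal, so they reduce onto exactly the alternating matrices
  (\<open>reduction_so_matrices\<close>), whatever the residue characteristic.
\<close>

section \<open>Finite sets of matrices and vectors\<close>


lemma card_vimage_of_equal_fibres:
  assumes fin: "finite S" "finite G" and phi: "\<phi> \<in> S \<rightarrow> G"
    and le: "\<And>r s. r \<in> G \<Longrightarrow> s \<in> G \<Longrightarrow> card {A \<in> S. \<phi> A = r} \<le> card {A \<in> S. \<phi> A = s}"
    and T: "T \<subseteq> G"
  shows "card {A \<in> S. \<phi> A \<in> T} * card G = card S * card T"
proof (cases "G = {}")
  case True
  then show ?thesis using phi T by auto
next
  case False
  then obtain r0 where r0: "r0 \<in> G" by blast
  define F where "F = card {A \<in> S. \<phi> A = r0}"
  have F: "card {A \<in> S. \<phi> A = r} = F" if "r \<in> G" for r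
    unfolding F_def using le[OF that r0] le[OF r0 that] by simp
  have count: "card {A \<in> S. \<phi> A \<in> U} = card U * F" if U: "U \<subseteq> G" for U
  proof -
    have finU: "finite U" using finite_subset[OF U fin(2)] .
    have "card {A \<in> S. \<phi> A \<in> U} = (\<Sum>r\<in>U. card {A \<in> {A \<in> S. \<phi> A \<in> U}. \<phi> A = r})"
      using sum.group[of "{A \<in> S. \<phi> A \<in> U}" U \<phi> "\<lambda>_. 1::nat"] fin finU by (simp add: image_subset_iff)
    also have "\<dots> = (\<Sum>r\<in>U. F)"
      by (intro sum.cong refl, subst F[symmetric]) (use U in \<open>auto intro!: arg_cong[of _ _ card]\<close>)
    finally show ?thesis by simp
  qed
  have "{A \<in> S. \<phi> A \<in> G} = S" using phi by auto
  then have "card S = card G * F" using count[of G] by simp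
  with count[OF T] show ?thesis by simp
qed

lemma finite_matrices_over:
  assumes "finite (carrier R)"
  shows "finite (matrices_over R d e)"
proof (rule finite_subset)
  show "matrices_over R d e \<subseteq> (\<lambda>f. mat d e f) ` PiE ({..<d} \<times> {..<e}) (\<lambda>_. carrier R)"
  proof
    fix A assume A: "A \<in> matrices_over R d e"
    then have "A = mat d e (restrict (\<lambda>p. A $$ p) ({..<d} \<times> {..<e}))"
      by (intro eq_matI) (auto simp: matrices_over_def)
    moreover have "restrict (\<lambda>p. A $$ p) ({..<d} \<times> {..<e}) \<in> PiE ({..<d} \<times> {..<e}) (\<lambda>_. carrier R)"
      using A by (intro restrict_PiE_iff[THEN iffD2]) (auto simp: matrices_over_def)
    ultimately show "A \<in> (\<lambda>f. mat d e f) ` PiE ({..<d} \<times> {..<e}) (\<lambda>_. carrier R)"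
      by (rule image_eqI)
  qed
qed (intro finite_imageI finite_PiE finite_cartesian_product finite_lessThan assms)

lemma matrices_overI:
  assumes "A \<in> carrier_mat d e" "\<And>i j. i < d \<Longrightarrow> j < e \<Longrightarrow> A $$ (i,j) \<in> carrier R"
  shows "A \<in> matrices_over R d e"
  using assms by (auto simp: matrices_over_def)

lemma matrices_over_entry:
  "A \<in> matrices_over R d e \<Longrightarrow> i < d \<Longrightarrow> j < e \<Longrightarrow> A $$ (i,j) \<in> carrier R"
  by (auto simp: matrices_over_def)

text \<open>
  The diagonal condition is separate because in a ring where \<open>2\<close> is a zero divisor, as in
  residue characteristic \<open>2\<close>, it does not follow from skew-symmetry.
\<close>

definition alternating_matrices :: "('a, 'b) ring_scheme \<Rightarrow> nat \<Rightarrow> 'a mat set" where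
  "alternating_matrices R d =
     {A \<in> matrices_over R d d. (\<forall>i<d. A $$ (i,i) = \<zero>\<^bsub>R\<^esub>) \<and>
        (\<forall>i<d. \<forall>j<d. A $$ (j,i) = \<ominus>\<^bsub>R\<^esub> A $$ (i,j))}"

definition vectors_over :: "'a set \<Rightarrow> nat \<Rightarrow> 'a vec set" where
  "vectors_over X d = {x \<in> carrier_vec d. set\<^sub>v x \<subseteq> X}"

lemma bij_betw_vectors_over: "bij_betw (\<lambda>f. vec d f) (PiE {..<d} (\<lambda>_. X)) (vectors_over X d)"
proof (rule bij_betw_imageI)
  show "inj_on (\<lambda>f. vec d f) (PiE {..<d} (\<lambda>_. X))"
  proof (rule inj_onI)
    fix f g assume f: "f \<in> PiE {..<d} (\<lambda>_. X)" and g: "g \<in> PiE {..<d} (\<lambda>_. X)"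
      and eq: "vec d f = vec d g"
    have "f i = g i" if "i \<in> {..<d}" for i
      using arg_cong[OF eq, of "\<lambda>v. v $ i"] that by simp
    from PiE_ext[OF f g this] show "f = g" .
  qed
  show "(\<lambda>f. vec d f) ` PiE {..<d} (\<lambda>_. X) = vectors_over X d"
  proof (intro equalityI subsetI)
    fix x assume x: "x \<in> vectors_over X d"
    then have "x = vec d (restrict (\<lambda>i. x $ i) {..<d})"
      by (intro eq_vecI) (auto simp: vectors_over_def)
    moreover have "restrict (\<lambda>i. x $ i) {..<d} \<in> PiE {..<d} (\<lambda>_. X)"
      using x by (intro restrict_PiE_iff[THEN iffD2]) (auto simp: vectors_over_def vec_set_def)
    ultimately show "x \<in> (\<lambda>f. vec d f) ` PiE {..<d} (\<lambda>_. X)" by (rule image_eqI)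
  next
    fix x assume "x \<in> (\<lambda>f. vec d f) ` PiE {..<d} (\<lambda>_. X)"
    then obtain f where f: "f \<in> PiE {..<d} (\<lambda>_. X)" and x: "x = vec d f" by blast
    have "x $ i \<in> X" if "i < d" for i using PiE_mem[OF f, of i] that by (simp add: x)
    then show "x \<in> vectors_over X d" by (auto simp: vectors_over_def vec_set_def x)
  qed
qed

lemma card_vectors_over: "card (vectors_over X d) = card X ^ d"
  using bij_betw_same_card[OF bij_betw_vectors_over[of d X]] by (simp add: card_PiE)

lemma finite_vectors_over: "finite X \<Longrightarrow> finite (vectors_over X d)"
  using bij_betw_finite[OF bij_betw_vectors_over[of d X]] by (simp add: finite_PiE)

section \<open>Matrices killing a row vector with a pivot entry\<close>

context cring begin

definition row_comb :: "nat \<Rightarrow> (nat \<Rightarrow> 'a) \<Rightarrow> 'a mat \<Rightarrow> nat \<Rightarrow> 'a" where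
  "row_comb d c A j = (\<Oplus>i\<in>{..<d}. c i \<otimes> A $$ (i,j))"

lemma row_comb_closed:
  assumes "A \<in> matrices_over R d e" "c \<in> {..<d} \<rightarrow> carrier R" "j < e"
  shows "row_comb d c A j \<in> carrier R"
  unfolding row_comb_def using assms
  by (intro finsum_closed) (auto intro!: m_closed matrices_over_entry)

text \<open>
  \<open>E \<delta>\<close> is a correction that stays inside \<open>S\<close> and, on the columns \<open>J\<close>, is concentrated in the pivot
  row \<open>p\<close> with entries \<open>\<delta>\<close>. As \<open>c p = \<one>\<close>, adding it to \<open>A\<close> translates the restriction of \<open>c A\<close> to \<open>J\<close> by \<open>\<delta>\<close>,
  so all fibres of \<open>A \<mapsto> (c A)|\<^sub>J\<close> have the same size; the matrices counted are those that this map
  sends into \<open>Ann a\<close> to the power \<open>J\<close>.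
\<close>

lemma card_pivot_kernel:
  assumes finR: "finite (carrier R)"
    and S: "S \<subseteq> matrices_over R d e"
    and J: "J \<subseteq> {..<e}"
    and c: "c \<in> {..<d} \<rightarrow> carrier R" and p: "p < d" "c p = \<one>"
    and E_closed: "\<And>\<delta> i j. \<delta> \<in> J \<rightarrow> carrier R \<Longrightarrow> i < d \<Longrightarrow> j < e \<Longrightarrow> E \<delta> i j \<in> carrier R"
    and E_pivot: "\<And>\<delta> j. j \<in> J \<Longrightarrow> E \<delta> p j = \<delta> j"
    and E_off: "\<And>\<delta> i j. i < d \<Longrightarrow> i \<noteq> p \<Longrightarrow> j \<in> J \<Longrightarrow> E \<delta> i j = \<zero>"
    and E_S: "\<And>\<delta> A. \<delta> \<in> J \<rightarrow> carrier R \<Longrightarrow> A \<in> S \<Longrightarrow>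
                 mat d e (\<lambda>(i,j). A $$ (i,j) \<oplus> E \<delta> i j) \<in> S"
  shows "card {A \<in> S. \<forall>j\<in>J. a \<otimes> row_comb d c A j = \<zero>} * card (carrier R) ^ card J
         = card S * card {b \<in> carrier R. a \<otimes> b = \<zero>} ^ card J"
proof -
  define Ann where "Ann = {b \<in> carrier R. a \<otimes> b = \<zero>}"
  define G where "G = PiE J (\<lambda>_. carrier R)"
  define \<phi> where "\<phi> = (\<lambda>A. restrict (row_comb d c A) J)"
  have finJ: "finite J" using finite_subset[OF J] by simp
  have finS: "finite S" using finite_subset[OF S finite_matrices_over[OF finR]] .
  have finG: "finite G" unfolding G_def using finJ finR by (intro finite_PiE) auto
  have cl: "row_comb d c A j \<in> carrier R" if "A \<in> S" "j \<in> J" for A j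
    using row_comb_closed[of A d e c j] that S J c by auto
  have \<phi>: "\<phi> \<in> S \<rightarrow> G" by (simp add: Pi_iff \<phi>_def G_def restrict_PiE_iff cl)
  have "card {A \<in> S. \<phi> A = r} \<le> card {A \<in> S. \<phi> A = s}" if r: "r \<in> G" and s: "s \<in> G" for r s
  proof -
    define \<delta> where "\<delta> = (\<lambda>j. s j \<ominus> r j)"
    have rs: "r j \<in> carrier R" "s j \<in> carrier R" if "j \<in> J" for j
      using r s that by (auto simp: G_def)
    have \<delta>: "\<delta> \<in> J \<rightarrow> carrier R" using rs by (auto simp: \<delta>_def)
    define h where "h = (\<lambda>A. mat d e (\<lambda>(i,j). A $$ (i,j) \<oplus> E \<delta> i j))"
    have shift: "row_comb d c (h A) j = row_comb d c A j \<oplus> \<delta> j" if A: "A \<in> S" and j: "j \<in> J" for A j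
    proof -
      have je: "j < e" using J j by auto
      have ent: "A $$ (i,j) \<in> carrier R" if "i < d" for i
        using matrices_over_entry[of A R d e i j] A S that je by auto
      have ci: "c i \<in> carrier R" if "i < d" for i using c that by auto
      have Eij: "E \<delta> i j = (if i = p then \<delta> j else \<zero>)" if "i < d" for i
        using E_pivot E_off that j by auto
      have dj: "\<delta> j \<in> carrier R" using \<delta> j by auto
      have "row_comb d c (h A) j = (\<Oplus>i\<in>{..<d}. c i \<otimes> A $$ (i,j) \<oplus> (if i = p then \<delta> j else \<zero>))"
        unfolding row_comb_def h_def
        by (rule finsum_cong') (auto simp: Eij je ent ci r_distr dj p)
      also have "\<dots> = row_comb d c A j \<oplus> (\<Oplus>i\<in>{..<d}. if i = p then \<delta> j else \<zero>)"
        unfolding row_comb_def by (rule finsum_addf) (auto simp: ent ci dj)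
      also have "(\<Oplus>i\<in>{..<d}. if i = p then \<delta> j else \<zero>) = \<delta> j"
        using add.finprod_singleton_swap[of p "{..<d}" "\<lambda>_. \<delta> j"] p dj by auto
      finally show ?thesis .
    qed
    show ?thesis
    proof (rule card_inj_on_le[where f = h])
      show "inj_on h {A \<in> S. \<phi> A = r}"
      proof (rule inj_onI)
        fix A B assume A: "A \<in> {A \<in> S. \<phi> A = r}" and B: "B \<in> {A \<in> S. \<phi> A = r}" and eq: "h A = h B"
        have AM: "A \<in> matrices_over R d e" and BM: "B \<in> matrices_over R d e" using A B S by auto
        show "A = B"
        proof (rule eq_matI)
          fix i j assume "i < dim_row B" "j < dim_col B"
          then have ij: "i < d" "j < e" using BM by (auto simp: matrices_over_def)
          have "h A $$ (i,j) = h B $$ (i,j)" using eq by simp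
          then have "A $$ (i,j) \<oplus> E \<delta> i j = B $$ (i,j) \<oplus> E \<delta> i j" using ij by (simp add: h_def)
          then show "A $$ (i,j) = B $$ (i,j)"
            using matrices_over_entry[OF AM ij] matrices_over_entry[OF BM ij] E_closed[OF \<delta> ij]
            by (simp add: add.right_cancel)
        qed (use AM BM in \<open>auto simp: matrices_over_def\<close>)
      qed
      show "h ` {A \<in> S. \<phi> A = r} \<subseteq> {A \<in> S. \<phi> A = s}"
      proof safe
        fix A assume A: "A \<in> S" and r_def: "r = \<phi> A"
        show "h A \<in> S" unfolding h_def by (rule E_S[OF \<delta> A])
        show "\<phi> (h A) = s"
        proof
          fix j
          show "\<phi> (h A) j = s j"
          proof (cases "j \<in> J")
            case True
            have "row_comb d c A j = r j" using True by (simp add: r_def \<phi>_def)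
            then have "\<phi> (h A) j = r j \<oplus> (s j \<ominus> r j)"
              using shift[OF A True] True by (simp add: \<phi>_def \<delta>_def)
            also have "\<dots> = s j" using rs[OF True] by (simp add: minus_eq a_lcomm[of "r j" "s j"] r_neg)
            finally show ?thesis .
          next
            case False
            then show ?thesis using s by (auto simp: \<phi>_def G_def PiE_def extensional_def)
          qed
        qed
      qed
    qed (use finS in auto)
  qed
  from card_vimage_of_equal_fibres[OF finS finG \<phi> this, of "PiE J (\<lambda>_. Ann)"]
  have "card {A \<in> S. \<phi> A \<in> PiE J (\<lambda>_. Ann)} * card G = card S * card (PiE J (\<lambda>_. Ann))"
    unfolding G_def by (simp add: Ann_def PiE_mono)
  moreover have "{A \<in> S. \<phi> A \<in> PiE J (\<lambda>_. Ann)} = {A \<in> S. \<forall>j\<in>J. a \<otimes> row_comb d c A j = \<zero>}"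
    by (rule Collect_cong, rule conj_cong[OF refl]) (simp add: \<phi>_def restrict_PiE_iff Ann_def cl Pi_iff)
  moreover have "card G = card (carrier R) ^ card J" and "card (PiE J (\<lambda>_. Ann)) = card Ann ^ card J"
    by (simp_all add: G_def card_PiE[OF finJ])
  ultimately show ?thesis by (simp only: Ann_def)
qed

lemma mem_row_kernel_multiple:
  assumes A: "A \<in> matrices_over R d e" and x: "x \<in> vectors_over (carrier R) d"
    and a: "a \<in> carrier R" and c: "c \<in> {..<d} \<rightarrow> carrier R"
    and xc: "\<And>i. i < d \<Longrightarrow> x $ i = a \<otimes> c i"
  shows "x \<in> row_kernel R A \<longleftrightarrow> (\<forall>j<e. a \<otimes> row_comb d c A j = \<zero>)"
proof -
  have dims: "dim_row A = d" "dim_col A = e" using A by (auto simp: matrices_over_def)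
  have "(\<Oplus>i\<in>{..<d}. x $ i \<otimes> A $$ (i,j)) = a \<otimes> row_comb d c A j" if j: "j < e" for j
  proof -
    have ent: "A $$ (i,j) \<in> carrier R" if "i < d" for i using matrices_over_entry[OF A that j] .
    have ci: "c i \<in> carrier R" if "i < d" for i using c that by auto
    have "(\<Oplus>i\<in>{..<d}. x $ i \<otimes> A $$ (i,j)) = (\<Oplus>i\<in>{..<d}. a \<otimes> (c i \<otimes> A $$ (i,j)))"
      by (rule finsum_cong') (auto simp: xc ent ci a m_assoc)
    also have "\<dots> = a \<otimes> row_comb d c A j"
      unfolding row_comb_def by (rule finsum_rdistr[symmetric]) (auto simp: ent ci a)
    finally show ?thesis .
  qed
  then show ?thesis using x unfolding row_kernel_def dims by (auto simp: vectors_over_def)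
qed

text \<open>
  The only information about a set of matrices that enters the average: a vector that is
  \<open>a\<close> times a vector with an entry \<open>\<one>\<close> is killed by a proportion \<open>(|Ann a| / |R|)^(d-1)\<close> of the set.
  The exponent is \<open>d - 1\<close> for \<open>d \<times> (d - 1)\<close> matrices and for alternating \<open>d \<times> d\<close> matrices alike.
\<close>

definition pivot_equidistributed :: "nat \<Rightarrow> 'a mat set \<Rightarrow> bool" where
  "pivot_equidistributed d S \<longleftrightarrow>
     (\<forall>x\<in>vectors_over (carrier R) d. \<forall>a\<in>carrier R. \<forall>c\<in>{..<d} \<rightarrow> carrier R. \<forall>k<d.
        c k = \<one> \<longrightarrow> (\<forall>i<d. x $ i = a \<otimes> c i) \<longrightarrow>
        card {A \<in> S. x \<in> row_kernel R A} * card (carrier R) ^ (d - 1)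
          = card S * card {b \<in> carrier R. a \<otimes> b = \<zero>} ^ (d - 1))"

lemma pivot_equidistributed_all:
  assumes finR: "finite (carrier R)"
  shows "pivot_equidistributed d (matrices_over R d (d - 1))"
  unfolding pivot_equidistributed_def
proof (intro ballI allI impI)
  fix x a c k
  assume x: "x \<in> vectors_over (carrier R) d" and a: "a \<in> carrier R"
    and c: "c \<in> {..<d} \<rightarrow> carrier R" and k: "k < d" "c k = \<one>"
    and xc: "\<forall>i<d. x $ i = a \<otimes> c i"
  let ?S = "matrices_over R d (d - 1)"
  have "card {A \<in> ?S. \<forall>j\<in>{..<d-1}. a \<otimes> row_comb d c A j = \<zero>} * card (carrier R) ^ card {..<d-1}
         = card ?S * card {b \<in> carrier R. a \<otimes> b = \<zero>} ^ card {..<d-1}"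
  proof (rule card_pivot_kernel[OF finR, where p = k and E = "\<lambda>\<delta> i j. if i = k then \<delta> j else \<zero>" and e = "d - 1"])
    fix \<delta> A assume \<delta>: "\<delta> \<in> {..<d - 1} \<rightarrow> carrier R" and A: "A \<in> ?S"
    show "mat d (d - 1) (\<lambda>(i,j). A $$ (i,j) \<oplus> (if i = k then \<delta> j else \<zero>)) \<in> ?S"
      using \<delta> matrices_over_entry[OF A] by (intro matrices_overI) auto
  qed (use c k in auto)
  moreover have "{A \<in> ?S. \<forall>j\<in>{..<d-1}. a \<otimes> row_comb d c A j = \<zero>} = {A \<in> ?S. x \<in> row_kernel R A}"
  proof (rule Collect_cong, rule conj_cong[OF refl])
    fix A assume A: "A \<in> ?S"
    show "(\<forall>j\<in>{..<d-1}. a \<otimes> row_comb d c A j = \<zero>) \<longleftrightarrow> x \<in> row_kernel R A"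
      using mem_row_kernel_multiple[OF A x a c] xc by auto
  qed
  ultimately show "card {A \<in> ?S. x \<in> row_kernel R A} * card (carrier R) ^ (d - 1)
          = card ?S * card {b \<in> carrier R. a \<otimes> b = \<zero>} ^ (d - 1)" by simp
qed

text \<open>
  The identity \<open>c A c\<^sup>T = 0\<close>. Halving \<open>c A c\<^sup>T = - c A c\<^sup>T\<close> is impossible when \<open>2\<close> is a zero divisor,
  so the terms \<open>(i,j)\<close> and \<open>(j,i)\<close> are cancelled against each other by induction on the size.
\<close>

lemma alternating_form_zero:
  fixes d :: nat
  assumes c: "\<And>i. i < d \<Longrightarrow> c i \<in> carrier R"
    and f: "\<And>i j. i < d \<Longrightarrow> j < d \<Longrightarrow> f i j \<in> carrier R"
    and diag: "\<And>i. i < d \<Longrightarrow> f i i = \<zero>"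
    and alt: "\<And>i j. i < d \<Longrightarrow> j < d \<Longrightarrow> f j i = \<ominus> f i j"
  shows "(\<Oplus>j\<in>{..<d}. c j \<otimes> (\<Oplus>i\<in>{..<d}. c i \<otimes> f i j)) = \<zero>"
  using assms
proof (induction d)
  case 0
  show ?case by simp
next
  case (Suc d)
  have c: "c i \<in> carrier R" if "i \<le> d" for i using Suc.prems(1) that by simp
  have f: "f i j \<in> carrier R" if "i \<le> d" "j \<le> d" for i j using Suc.prems(2) that by simp
  have IH: "(\<Oplus>j\<in>{..<d}. c j \<otimes> (\<Oplus>i\<in>{..<d}. c i \<otimes> f i j)) = \<zero>"
    by (rule Suc.IH; rule Suc.prems; simp)
  define s where "s = (\<Oplus>i\<in>{..<d}. c i \<otimes> f i d)"
  have s: "s \<in> carrier R" unfolding s_def by (intro finsum_closed) (auto simp: c f)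
  have inner: "(\<Oplus>i\<in>{..<d}. c i \<otimes> f i j) \<in> carrier R" if "j \<le> d" for j
    using that by (intro finsum_closed) (auto simp: c f)
  have split: "(\<Oplus>i\<in>{..<Suc d}. c i \<otimes> f i j) = c d \<otimes> f d j \<oplus> (\<Oplus>i\<in>{..<d}. c i \<otimes> f i j)"
    if "j \<le> d" for j
    unfolding lessThan_Suc using that by (intro finsum_insert) (auto simp: c f)
  have fdd: "f d d = \<zero>" using Suc.prems(3) by simp
  have last: "(\<Oplus>i\<in>{..<Suc d}. c i \<otimes> f i d) = s"
    using split[of d] s by (simp add: fdd c s_def[symmetric])
  have fdj: "f d j = \<ominus> f j d" if "j < d" for j using Suc.prems(4)[of j d] that by simp
  have "(\<Oplus>j\<in>{..<d}. c j \<otimes> (\<Oplus>i\<in>{..<Suc d}. c i \<otimes> f i j))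
      = (\<Oplus>j\<in>{..<d}. (\<ominus> c d) \<otimes> (c j \<otimes> f j d) \<oplus> c j \<otimes> (\<Oplus>i\<in>{..<d}. c i \<otimes> f i j))"
  proof (rule finsum_cong')
    fix j assume "j \<in> {..<d}"
    then have j: "j < d" by simp
    then show "c j \<otimes> (\<Oplus>i\<in>{..<Suc d}. c i \<otimes> f i j) =
       (\<ominus> c d) \<otimes> (c j \<otimes> f j d) \<oplus> c j \<otimes> (\<Oplus>i\<in>{..<d}. c i \<otimes> f i j)"
      using split[of j] inner[of j] c f
      by (simp add: fdj r_distr l_minus r_minus m_lcomm)
  qed (auto simp: c f inner)
  also have "\<dots> = (\<Oplus>j\<in>{..<d}. (\<ominus> c d) \<otimes> (c j \<otimes> f j d)) \<oplus> \<zero>"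
    unfolding IH[symmetric] by (rule finsum_addf) (auto simp: c f inner)
  also have "(\<Oplus>j\<in>{..<d}. (\<ominus> c d) \<otimes> (c j \<otimes> f j d)) = (\<ominus> c d) \<otimes> s"
    unfolding s_def by (rule finsum_rdistr[symmetric]) (auto simp: c f)
  finally have rest: "(\<Oplus>j\<in>{..<d}. c j \<otimes> (\<Oplus>i\<in>{..<Suc d}. c i \<otimes> f i j)) = (\<ominus> c d) \<otimes> s"
    using s c by simp
  have "(\<Oplus>j\<in>{..<Suc d}. c j \<otimes> (\<Oplus>i\<in>{..<Suc d}. c i \<otimes> f i j))
      = c d \<otimes> (\<Oplus>i\<in>{..<Suc d}. c i \<otimes> f i d) \<oplus> (\<Oplus>j\<in>{..<d}. c j \<otimes> (\<Oplus>i\<in>{..<Suc d}. c i \<otimes> f i j))"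
    unfolding lessThan_Suc[of d]
    by (intro finsum_insert) (auto simp: c f intro!: finsum_closed m_closed)
  then show ?case using last rest s c by (simp add: l_minus r_neg)
qed

text \<open>
  The pivot column is left out of the count: it is the one column of \<open>c A\<close> that cannot be
  prescribed freely. Its equation comes for free, since \<open>c A c\<^sup>T = 0\<close> expresses \<open>(c A)\<^sub>k\<close> through the
  other entries.
\<close>

lemma pivot_equidistributed_alternating:
  assumes finR: "finite (carrier R)"
  shows "pivot_equidistributed d (alternating_matrices R d)"
  unfolding pivot_equidistributed_def
proof (intro ballI allI impI)
  fix x a c k
  assume x: "x \<in> vectors_over (carrier R) d" and a: "a \<in> carrier R"
    and c: "c \<in> {..<d} \<rightarrow> carrier R" and k: "k < d" "c k = \<one>"
    and xc: "\<forall>i<d. x $ i = a \<otimes> c i"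
  let ?S = "alternating_matrices R d"
  let ?J = "{..<d} - {k}"
  \<comment> \<open>Changing row \<open>k\<close> by \<open>\<delta>\<close> forces column \<open>k\<close> to change by \<open>- \<delta>\<close>.\<close>
  let ?E = "\<lambda>\<delta> i j. if i = k \<and> j \<noteq> k then \<delta> j else if j = k \<and> i \<noteq> k then \<ominus> \<delta> i else \<zero>"
  have S: "?S \<subseteq> matrices_over R d d" unfolding alternating_matrices_def by blast
  have "card {A \<in> ?S. \<forall>j\<in>?J. a \<otimes> row_comb d c A j = \<zero>} * card (carrier R) ^ card ?J
         = card ?S * card {b \<in> carrier R. a \<otimes> b = \<zero>} ^ card ?J"
  proof (rule card_pivot_kernel[OF finR S, where p = k and E = ?E])
    fix \<delta> A assume \<delta>: "\<delta> \<in> ?J \<rightarrow> carrier R" and A: "A \<in> ?S"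
    have ent: "A $$ (i,j) \<in> carrier R" if "i < d" "j < d" for i j
      using matrices_over_entry A S that by blast
    have diag: "A $$ (i,i) = \<zero>" if "i < d" for i
      using A that unfolding alternating_matrices_def by blast
    have alt: "A $$ (j,i) = \<ominus> A $$ (i,j)" if "i < d" "j < d" for i j
      using A that unfolding alternating_matrices_def by blast
    have \<delta>c: "\<delta> i \<in> carrier R" if "i < d" "i \<noteq> k" for i using \<delta> that by auto
    show "mat d d (\<lambda>(i,j). A $$ (i,j) \<oplus> ?E \<delta> i j) \<in> ?S"
      unfolding alternating_matrices_def
    proof (intro CollectI conjI allI impI)
      show "mat d d (\<lambda>(i,j). A $$ (i,j) \<oplus> ?E \<delta> i j) \<in> matrices_over R d d"
        by (rule matrices_overI) (auto simp: ent \<delta>c)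
    next
      fix i assume "i < d"
      then show "mat d d (\<lambda>(i,j). A $$ (i,j) \<oplus> ?E \<delta> i j) $$ (i,i) = \<zero>" by (simp add: diag)
    next
      fix i j assume ij: "i < d" "j < d"
      show "mat d d (\<lambda>(i,j). A $$ (i,j) \<oplus> ?E \<delta> i j) $$ (j,i)
          = \<ominus> mat d d (\<lambda>(i,j). A $$ (i,j) \<oplus> ?E \<delta> i j) $$ (i,j)"
      proof (cases "i = j")
        case True
        then show ?thesis using ij by (simp add: diag)
      next
        case False
        show ?thesis using False ij \<delta>c ent[OF ij] by (auto simp: alt[OF ij] minus_add)
      qed
    qed
  qed (use c k in auto)
  moreover have "{A \<in> ?S. \<forall>j\<in>?J. a \<otimes> row_comb d c A j = \<zero>} = {A \<in> ?S. x \<in> row_kernel R A}"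
  proof (rule Collect_cong, rule conj_cong[OF refl])
    fix A assume A: "A \<in> ?S"
    then have AM: "A \<in> matrices_over R d d" using S by auto
    have cl: "row_comb d c A j \<in> carrier R" if "j < d" for j
      using row_comb_closed[OF AM c that] .
    have "a \<otimes> row_comb d c A k = \<zero>" if z: "\<forall>j\<in>?J. a \<otimes> row_comb d c A j = \<zero>"
    proof -
      have "\<And>i. i < d \<Longrightarrow> A $$ (i,i) = \<zero>"
        and "\<And>i j. i < d \<Longrightarrow> j < d \<Longrightarrow> A $$ (j,i) = \<ominus> A $$ (i,j)"
        using A unfolding alternating_matrices_def by blast+
      then have "(\<Oplus>j\<in>{..<d}. c j \<otimes> (\<Oplus>i\<in>{..<d}. c i \<otimes> A $$ (i,j))) = \<zero>"
        by (intro alternating_form_zero matrices_over_entry[OF AM]) (use c in blast)+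
      then have "(\<Oplus>j\<in>{..<d}. c j \<otimes> row_comb d c A j) = \<zero>" by (simp add: row_comb_def)
      \<comment> \<open>All terms of \<open>a (c A c\<^sup>T)\<close> but the one at the pivot \<open>k\<close> vanish by hypothesis.\<close>
      then have "\<zero> = a \<otimes> (\<Oplus>j\<in>{..<d}. c j \<otimes> row_comb d c A j)" using a by simp
      also have "\<dots> = (\<Oplus>j\<in>{..<d}. a \<otimes> (c j \<otimes> row_comb d c A j))"
        by (rule finsum_rdistr) (use a c cl in auto)
      also have "\<dots> = (\<Oplus>j\<in>{..<d}. if j = k then a \<otimes> row_comb d c A k else \<zero>)"
      proof (rule finsum_cong')
        fix j assume "j \<in> {..<d}"
        then have j: "j < d" by simp
        show "a \<otimes> (c j \<otimes> row_comb d c A j) = (if j = k then a \<otimes> row_comb d c A k else \<zero>)"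
        proof (cases "j = k")
          case True
          then show ?thesis using k cl[OF k(1)] by simp
        next
          case False
          have cj: "c j \<in> carrier R" using c j by auto
          have "a \<otimes> (c j \<otimes> row_comb d c A j) = c j \<otimes> (a \<otimes> row_comb d c A j)"
            using a cj cl[OF j] by (rule m_lcomm)
          then show ?thesis using z j False cj by simp
        qed
      qed (use a cl k in auto)
      also have "\<dots> = a \<otimes> row_comb d c A k"
        using add.finprod_singleton_swap[of k "{..<d}" "\<lambda>_. a \<otimes> row_comb d c A k"] k a cl by auto
      finally show ?thesis by simp
    qed
    then have "(\<forall>j\<in>?J. a \<otimes> row_comb d c A j = \<zero>) \<longleftrightarrow> (\<forall>j<d. a \<otimes> row_comb d c A j = \<zero>)"
      by (metis Diff_iff lessThan_iff singletonD)
    then show "(\<forall>j\<in>?J. a \<otimes> row_comb d c A j = \<zero>) \<longleftrightarrow> x \<in> row_kernel R A"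
      using mem_row_kernel_multiple[OF AM x a c] xc by auto
  qed
  ultimately show "card {A \<in> ?S. x \<in> row_kernel R A} * card (carrier R) ^ (d - 1)
          = card ?S * card {b \<in> carrier R. a \<otimes> b = \<zero>} ^ (d - 1)" using k by simp
qed

end

section \<open>The average kernel size over a finite chain ring\<close>

text \<open>
  Here \<open>I k\<close> plays the part of \<open>\<PP>^k/\<PP>^n\<close> and \<open>q\<close> that of the residue field size. The elements of
  \<open>I k - I (Suc k)\<close> are those of valuation \<open>k\<close>; each of them generates \<open>I k\<close>, and the
  annihilator of each has the size of \<open>I (n - k)\<close>.
\<close>

locale finite_chain_ring = cring R for R :: "('a, 'b) ring_scheme" (structure) +
  fixes I :: "nat \<Rightarrow> 'a set" and n q :: nat
  assumes q_pos: "q > 0"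
    and I_0: "I 0 = carrier R"
    and I_n: "I n = {\<zero>}"
    and I_Suc: "k < n \<Longrightarrow> I (Suc k) \<subseteq> I k"
    and card_I: "k \<le> n \<Longrightarrow> card (I k) = q ^ (n - k)"
    and divides: "k < n \<Longrightarrow> a \<in> I k - I (Suc k) \<Longrightarrow> b \<in> I k \<Longrightarrow> \<exists>c\<in>carrier R. b = a \<otimes> c"
    and card_annihilator: "k < n \<Longrightarrow> a \<in> I k - I (Suc k) \<Longrightarrow> card {b \<in> carrier R. a \<otimes> b = \<zero>} = q ^ k"
begin

lemma finite_carrier: "finite (carrier R)"
  using card_I[of 0] q_pos by (simp add: I_0 card_ge_0_finite)

lemma I_subset: "k \<le> n \<Longrightarrow> I k \<subseteq> carrier R"
  by (induction k) (use I_0 I_Suc in \<open>auto dest!: Suc_le_lessD\<close>)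

text \<open>
  An entry of smallest valuation serves as the pivot.
\<close>

lemma annihilating_proportion:
  assumes S: "pivot_equidistributed d S" "finite S" "S \<noteq> {}" and k: "k < n"
    and x: "x \<in> vectors_over (I k) d - vectors_over (I (Suc k)) d"
  shows "of_nat (card {A \<in> S. x \<in> row_kernel R A}) / (of_nat (card S) :: rat)
         = 1 / of_nat q ^ ((n - k) * (d - 1))"
proof -
  have xI: "x $ i \<in> I k" if "i < d" for i
    using x that by (auto simp: vectors_over_def vec_set_def image_subset_iff)
  obtain i0 where i0: "i0 < d" "x $ i0 \<notin> I (Suc k)"
    using x by (auto simp: vectors_over_def vec_set_def image_subset_iff)
  define a where "a = x $ i0"
  have aI: "a \<in> I k - I (Suc k)" using i0 xI by (simp add: a_def)
  have sub: "I k \<subseteq> carrier R" using I_subset k by simp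
  have a: "a \<in> carrier R" using aI sub by auto
  have "\<forall>i. \<exists>c. i < d \<longrightarrow> c \<in> carrier R \<and> x $ i = a \<otimes> c \<and> (i = i0 \<longrightarrow> c = \<one>)"
    using divides[OF k aI xI] a by (metis a_def one_closed r_one)
  then obtain c where c: "\<And>i. i < d \<Longrightarrow> c i \<in> carrier R \<and> x $ i = a \<otimes> c i \<and> (i = i0 \<longrightarrow> c i = \<one>)"
    by metis
  have "x \<in> vectors_over (carrier R) d" using x sub by (auto simp: vectors_over_def)
  then have eq: "card {A \<in> S. x \<in> row_kernel R A} * card (carrier R) ^ (d - 1)
          = card S * card {b \<in> carrier R. a \<otimes> b = \<zero>} ^ (d - 1)"
    using S(1)[unfolded pivot_equidistributed_def, rule_format, of x a c i0] a c i0 by auto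
  have cardR: "card (carrier R) = q ^ n" using card_I[of 0] by (simp add: I_0)
  have "n = k + (n - k)" using k by simp
  then have "q ^ n = q ^ k * q ^ (n - k)" by (metis power_add)
  with eq have "card {A \<in> S. x \<in> row_kernel R A} * (q ^ (n - k)) ^ (d - 1) * (q ^ k) ^ (d - 1)
       = card S * (q ^ k) ^ (d - 1)"
    by (simp add: cardR card_annihilator[OF k aI] power_mult_distrib mult_ac)
  then have "card {A \<in> S. x \<in> row_kernel R A} * q ^ ((n - k) * (d - 1)) = card S"
    using q_pos by (simp add: power_mult)
  then have "of_nat (card {A \<in> S. x \<in> row_kernel R A}) * of_nat q ^ ((n - k) * (d - 1)) = (of_nat (card S) :: rat)"
    by (metis of_nat_mult of_nat_power)
  moreover have "of_nat (card S) \<noteq> (0::rat)" using S by simp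
  ultimately show ?thesis using q_pos by (simp add: field_simps)
qed

text \<open>
  The sum over row vectors is built up from the zero vector, one valuation at a time: the vectors
  of valuation \<open>n - m\<close> add \<open>q^m - q^(m-d)\<close>.
\<close>

lemma average_kernel_size:
  assumes S: "pivot_equidistributed d S" "S \<subseteq> matrices_over R d e" "S \<noteq> {}" and d: "d \<ge> 1"
  shows "(\<Sum>A\<in>S. of_nat (card (row_kernel R A))) / (of_nat (card S) :: rat)
         = 1 + (\<Sum>m=1..n. of_nat q ^ m - of_nat q ^ m / of_nat q ^ d)"
proof -
  have finS: "finite S" using finite_subset[OF S(2) finite_matrices_over[OF finite_carrier]] .
  define V where "V = (\<lambda>k. vectors_over (I k) d)"
  define g :: "'a vec \<Rightarrow> rat" where
    "g = (\<lambda>x. of_nat (card {A \<in> S. x \<in> row_kernel R A}) / of_nat (card S))"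
  have finI: "finite (I k)" if "k \<le> n" for k
    using card_I[OF that] q_pos by (simp add: card_ge_0_finite)
  have finV: "finite (V k)" if "k \<le> n" for k unfolding V_def by (rule finite_vectors_over[OF finI[OF that]])
  have cardV: "of_nat (card (V k)) = (of_nat q ^ ((n - k) * d) :: rat)" if "k \<le> n" for k
    by (simp add: V_def card_vectors_over card_I[OF that] power_mult)
  \<comment> \<open>All kernels lie in \<open>V 0\<close>, so the pairs \<open>(A, x)\<close> can be counted with the sums interchanged.\<close>
  have kernel: "row_kernel R A = {x \<in> V 0. x \<in> row_kernel R A}" if "A \<in> S" for A
  proof -
    have "dim_row A = d" using S(2) that by (auto simp: matrices_over_def)
    then show ?thesis by (auto simp: row_kernel_def V_def vectors_over_def I_0)
  qed
  have "(\<Sum>A\<in>S. card (row_kernel R A)) = (\<Sum>A\<in>S. card {x \<in> V 0. x \<in> row_kernel R A})"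
    by (rule sum.cong[OF refl], rule arg_cong[of _ _ card], rule kernel)
  also have "\<dots> = (\<Sum>x\<in>V 0. card {A \<in> S. x \<in> row_kernel R A})"
    using sum.swap_restrict[OF finS finV[of 0], of "\<lambda>_ _. 1::nat" "\<lambda>A x. x \<in> row_kernel R A"]
    by simp
  finally have "(\<Sum>A\<in>S. of_nat (card (row_kernel R A))) / (of_nat (card S) :: rat) = (\<Sum>x\<in>V 0. g x)"
    by (simp add: g_def sum_divide_distrib[symmetric] flip: of_nat_sum)
  moreover have level_sum: "(\<Sum>x\<in>V (n - m). g x) = 1 + (\<Sum>i=1..m. of_nat q ^ i - of_nat q ^ i / of_nat q ^ d)"
    if "m \<le> n" for m
    using that
  proof (induction m)
    case 0
    have V: "V n = {vec d (\<lambda>_. \<zero>)}"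
      by (auto simp: V_def vectors_over_def I_n vec_set_def image_subset_iff intro!: eq_vecI)
    have "x \<in> row_kernel R A" if "A \<in> S" "x = vec d (\<lambda>_. \<zero>)" for A x
    proof -
      have A: "A \<in> matrices_over R d e" using S that by auto
      have "(\<Oplus>i\<in>{..<d}. x $ i \<otimes> A $$ (i,j)) = \<zero>" if "j < e" for j
        using matrices_over_entry[OF A _ that] \<open>x = _\<close> by (intro add.finprod_one_eqI) auto
      then show ?thesis using A that by (auto simp: row_kernel_def matrices_over_def vec_set_def)
    qed
    then have "{A \<in> S. vec d (\<lambda>_. \<zero>) \<in> row_kernel R A} = S" by auto
    then show ?case using S finS by (simp add: V g_def)
  next
    case (Suc m)
    define k where "k = n - Suc m"
    have k: "k < n" "n - m = Suc k" "n - k = Suc m" using Suc.prems by (auto simp: k_def)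
    have sub: "V (Suc k) \<subseteq> V k" using I_Suc[OF k(1)] by (auto simp: V_def vectors_over_def)
    have q0: "(of_nat q :: rat) \<noteq> 0" using q_pos by simp
    have mk: "n - Suc k = m" using k Suc.prems by simp
    have "of_nat (card (V k - V (Suc k))) = (of_nat q ^ (Suc m * d) - of_nat q ^ (m * d) :: rat)"
      using k finV sub cardV[of k] cardV[of "Suc k"] card_mono[OF finV sub]
      by (simp add: card_Diff_subset of_nat_diff mk del: power_Suc mult_Suc)
    moreover have "(\<Sum>x\<in>V k - V (Suc k). g x) = (\<Sum>x\<in>V k - V (Suc k). 1 / of_nat q ^ (Suc m * (d - 1)))"
      unfolding g_def using annihilating_proportion[OF S(1) finS S(3) k(1)] k(3)
      by (intro sum.cong) (auto simp: V_def)
    ultimately have "(\<Sum>x\<in>V k - V (Suc k). g x)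
        = (of_nat q ^ (Suc m * d) - of_nat q ^ (m * d)) / of_nat q ^ (Suc m * (d - 1))"
      by (simp del: mult_Suc)
    also have "\<dots> = of_nat q ^ Suc m - of_nat q ^ Suc m / of_nat q ^ d"
    proof -
      obtain d' where d': "d = Suc d'" using d by (cases d) auto
      have "Suc m * d = Suc m + Suc m * (d - 1)" by (simp add: d')
      then have 1: "of_nat q ^ (Suc m * d) = (of_nat q ^ Suc m * of_nat q ^ (Suc m * (d - 1)) :: rat)"
        by (metis power_add)
      have "m * d + d = Suc m + Suc m * (d - 1)" by (simp add: d')
      then have 2: "of_nat q ^ (m * d) * of_nat q ^ d = (of_nat q ^ Suc m * of_nat q ^ (Suc m * (d - 1)) :: rat)"
        by (metis power_add)
      have "of_nat q ^ (m * d) / (of_nat q ^ (Suc m * (d - 1)) :: rat) = of_nat q ^ Suc m / of_nat q ^ d"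
        using 2 q0 by (simp add: frac_eq_eq del: mult_Suc power_Suc)
      then show ?thesis unfolding diff_divide_distrib 1 using q0 by simp
    qed
    finally have "(\<Sum>x\<in>V k - V (Suc k). g x) = of_nat q ^ Suc m - of_nat q ^ Suc m / of_nat q ^ d" .
    moreover have "(\<Sum>x\<in>V k. g x) = (\<Sum>x\<in>V k - V (Suc k). g x) + (\<Sum>x\<in>V (Suc k). g x)"
      using sum.subset_diff[OF sub finV] k by simp
    ultimately show ?case using Suc.IH Suc.prems k by (simp add: k_def[symmetric])
  qed
  ultimately show ?thesis using level_sum[of n] by simp
qed

end


section \<open>Reduction of a valuation ring modulo powers of its maximal ideal\<close>

text \<open>
  A uniformizer \<open>\<pi>\<close> is fixed because the absolute value need not be normalised: comparing \<open>av x\<close>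
  with \<open>av \<pi> ^ k\<close> replaces comparing the valuation of \<open>x\<close> with \<open>k\<close>.
\<close>

locale uniformized_local_field = nonarch_local_field av for av :: "'a::field \<Rightarrow> real" +
  fixes \<pi> :: 'a
  assumes av_pi_pos: "0 < av \<pi>" and av_pi_less: "av \<pi> < 1"
    and value_group: "x \<noteq> 0 \<Longrightarrow> \<exists>k::int. av x = av \<pi> powi k"
begin

lemma av_one: "av 1 = 1"
  using multiplicative[of 1 1] eq_zero_iff[of 1] by simp

lemma av_zero: "av 0 = 0"
  using eq_zero_iff by simp

lemma av_minus: "av (- x) = av x"
proof -
  have "av (-1) * av (-1) = 1" using multiplicative[of "-1" "-1"] av_one by simp
  then have "(av (-1) - 1) * (av (-1) + 1) = 0" by (simp add: algebra_simps)
  then have "av (-1) = 1" using nonneg[of "-1"] by simp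
  then show ?thesis using multiplicative[of "-1" x] by simp
qed

lemma av_power: "av (x ^ k) = av x ^ k"
  by (induction k) (simp_all add: av_one multiplicative)

lemma av_divide: "av (x / y) = av x / av y"
proof (cases "y = 0")
  case False
  then have "av (x / y) * av y = av x" using multiplicative[of "x / y" y] by simp
  moreover have "av y \<noteq> 0" using False eq_zero_iff by simp
  ultimately show ?thesis by (simp add: field_simps)
qed (simp add: av_zero)

lemma av_add_le: "av x \<le> r \<Longrightarrow> av y \<le> r \<Longrightarrow> av (x + y) \<le> r"
  using ultrametric[of x y] by simp

lemma av_diff_le: "av x \<le> r \<Longrightarrow> av y \<le> r \<Longrightarrow> av (x - y) \<le> r"
  using av_add_le[of x r "- y"] av_minus by simp

text \<open>
  The ideal \<open>\<PP>^k\<close>, shown below to be \<open>ideal_power av k\<close>.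
\<close>

definition level :: "nat \<Rightarrow> 'a set" where
  "level k = {x. av x \<le> av \<pi> ^ k}"

abbreviation \<O> :: "'a ring" where "\<O> \<equiv> valuation_ring av"

lemma pi_nonzero: "\<pi> \<noteq> 0" using av_pi_pos av_zero by auto

lemma pi_power_pos: "0 < av \<pi> ^ k" using av_pi_pos by simp

lemma level_antimono:
  assumes "j \<le> k"
  shows "level k \<subseteq> level j"
proof -
  have "av \<pi> ^ k \<le> av \<pi> ^ j"
    using assms av_pi_pos av_pi_less by (intro power_decreasing) auto
  then show ?thesis by (auto simp: level_def)
qed

lemma carrier_O: "carrier \<O> = level 0"
  by (simp add: valuation_ring_def level_def)

lemma level_O: "x \<in> level k \<Longrightarrow> x \<in> carrier \<O>"
  using level_antimono[of 0 k] carrier_O by auto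

text \<open>
  No absolute value lies strictly between \<open>av \<pi> ^ (k + 1)\<close> and \<open>av \<pi> ^ k\<close>.
\<close>

lemma level_SucI:
  assumes "av x < av \<pi> ^ k"
  shows "x \<in> level (Suc k)"
proof (cases "x = 0")
  case True
  then show ?thesis using pi_power_pos[of "Suc k"] by (simp add: level_def av_zero less_imp_le)
next
  case False
  then obtain j :: int where j: "av x = av \<pi> powi j" using value_group by blast
  have "int k < j"
  proof (rule ccontr)
    assume "\<not> int k < j"
    then have "av \<pi> powi int k \<le> av \<pi> powi j"
      using av_pi_pos av_pi_less by (intro power_int_decreasing) auto
    then show False using assms j by (simp add: power_int_of_nat)
  qed
  then have "av \<pi> powi j \<le> av \<pi> powi int (Suc k)"
    using av_pi_pos av_pi_less by (intro power_int_decreasing) auto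
  then show ?thesis using j unfolding power_int_of_nat by (simp add: level_def)
qed

lemma av_eq_if_level:
  assumes "x \<in> level k" "x \<notin> level (Suc k)"
  shows "av x = av \<pi> ^ k"
  using assms level_SucI[of x k] by (fastforce simp: level_def)

lemma valuation_ideal_level: "valuation_ideal av = level 1"
  using level_SucI[of _ 0] av_pi_less by (auto simp: valuation_ideal_def level_def)

lemma mult_level: "x \<in> level j \<Longrightarrow> y \<in> level k \<Longrightarrow> x * y \<in> level (j + k)"
  unfolding level_def using nonneg by (auto simp: multiplicative power_add intro!: mult_mono)

lemma cring_O: "cring \<O>"
proof (rule cringI)
  show "abelian_group \<O>"
  proof (rule abelian_groupI)
    fix x assume "x \<in> carrier \<O>"
    then show "\<exists>y\<in>carrier \<O>. y \<oplus>\<^bsub>\<O>\<^esub> x = \<zero>\<^bsub>\<O>\<^esub>"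
      by (intro bexI[of _ "- x"]) (auto simp: valuation_ring_def av_minus)
  qed (auto simp: valuation_ring_def av_zero av_add_le)
  show "comm_monoid \<O>"
    using mult_level[of _ 0 _ 0] by (intro comm_monoidI) (auto simp: valuation_ring_def av_one level_def)
qed (auto simp: valuation_ring_def algebra_simps)

sublocale O: cring \<O> by (rule cring_O)

lemma O_ops: "x \<oplus>\<^bsub>\<O>\<^esub> y = x + y" "x \<otimes>\<^bsub>\<O>\<^esub> y = x * y" "\<zero>\<^bsub>\<O>\<^esub> = 0" "\<one>\<^bsub>\<O>\<^esub> = 1"
  by (simp_all add: valuation_ring_def)

lemma O_uminus:
  assumes "x \<in> carrier \<O>"
  shows "\<ominus>\<^bsub>\<O>\<^esub> x = - x"
proof (rule O.minus_equality)
  show "- x \<in> carrier \<O>" using assms by (simp add: valuation_ring_def av_minus)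
qed (use assms in \<open>simp_all add: O_ops\<close>)

lemma ideal_level: "ideal (level k) \<O>"
proof (rule idealI)
  show "ring \<O>" by (rule O.ring_axioms)
  show "subgroup (level k) (add_monoid \<O>)"
  proof (rule O.add.subgroupI)
    show "level k \<subseteq> carrier \<O>" using level_O by blast
    show "level k \<noteq> {}" using pi_power_pos[of k] by (auto simp: level_def av_zero less_imp_le intro!: exI[of _ 0])
    fix x assume x: "x \<in> level k"
    have "\<ominus>\<^bsub>\<O>\<^esub> x = - x" using O_uminus level_O x by blast
    then show "\<ominus>\<^bsub>\<O>\<^esub> x \<in> level k" using x by (simp add: level_def av_minus)
    fix y assume "y \<in> level k"
    then show "x \<oplus>\<^bsub>\<O>\<^esub> y \<in> level k" using x by (simp add: O_ops level_def av_add_le)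
  qed
  fix a x assume "a \<in> level k" "x \<in> carrier \<O>"
  then show "x \<otimes>\<^bsub>\<O>\<^esub> a \<in> level k" "a \<otimes>\<^bsub>\<O>\<^esub> x \<in> level k"
    using mult_level[of x 0 a k] mult_level[of a k x 0] by (auto simp: O_ops carrier_O)
qed

lemma divide_pi_power: "x \<in> level (j + k) \<Longrightarrow> x / \<pi> ^ k \<in> level j"
  using pi_power_pos[of k] by (simp add: level_def av_divide av_power power_add pos_divide_le_eq)

lemma ideal_power_level: "ideal_power av k = level k"
proof (induction k)
  case 0
  show ?case by (simp add: ideal_power_def nat_pow_def ideals_set_def carrier_O)
next
  case (Suc k)
  have "ideal_power av (Suc k) = ideal_prod \<O> (level k) (level 1)"
    using Suc unfolding ideal_power_def nat_pow_def
    by (simp add: ideals_set_def valuation_ideal_level)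
  also have "\<dots> = level (Suc k)"
  proof (intro equalityI subsetI)
    fix x assume "x \<in> ideal_prod \<O> (level k) (level 1)"
    then show "x \<in> level (Suc k)"
    proof induction
      case (prod i j)
      then show ?case using mult_level[of i k j 1] by (simp add: O_ops)
    next
      case (sum s1 s2)
      then show ?case by (simp add: O_ops level_def av_add_le)
    qed
  next
    fix x assume x: "x \<in> level (Suc k)"
    have "\<pi> \<in> level 1" by (simp add: level_def)
    moreover have "x / \<pi> \<in> level k" using divide_pi_power[of x k 1] x by simp
    ultimately have "(x / \<pi>) \<otimes>\<^bsub>\<O>\<^esub> \<pi> \<in> ideal_prod \<O> (level k) (level 1)"
      by (intro ideal_prod.prod)
    then show "x \<in> ideal_prod \<O> (level k) (level 1)" by (simp add: O_ops pi_nonzero)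
  qed
  finally show ?case .
qed

abbreviation truncation :: "nat \<Rightarrow> 'a set ring" where
  "truncation n \<equiv> \<O> Quot level n"

definition residue :: "nat \<Rightarrow> 'a \<Rightarrow> 'a set" where
  "residue n x = level n +>\<^bsub>\<O>\<^esub> x"

lemma cring_truncation: "cring (truncation n)"
  by (rule ideal.quotient_is_cring[OF ideal_level cring_O])

lemma residue_hom: "ring_hom_cring \<O> (truncation n) (residue n)"
  using ideal.rcos_ring_hom_cring[OF ideal_level cring_O] by (simp add: residue_def[abs_def])

lemma carrier_truncation: "carrier (truncation n) = residue n ` carrier \<O>"
  by (auto simp: FactRing_def A_RCOSETS_def' residue_def)

lemma residue_eq_iff:
  assumes x: "x \<in> carrier \<O>" and y: "y \<in> carrier \<O>"
  shows "residue n x = residue n y \<longleftrightarrow> x - y \<in> level n"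
  using O.quotient_eq_iff_same_a_r_cos[OF ideal_level x y, of n]
  by (simp add: residue_def O.minus_eq O_uminus[OF y] O_ops)

lemma residue_zero: "\<zero>\<^bsub>truncation n\<^esub> = residue n 0"
  using ring_hom_cring.hom_zero[OF residue_hom] by (simp add: O_ops)

lemma residue_mult: "x \<in> carrier \<O> \<Longrightarrow> y \<in> carrier \<O> \<Longrightarrow>
    residue n x \<otimes>\<^bsub>truncation n\<^esub> residue n y = residue n (x * y)"
  using ring_hom_mult[OF ideal.rcos_ring_hom[OF ideal_level]] by (simp add: residue_def O_ops)

lemma residue_uminus: "x \<in> carrier \<O> \<Longrightarrow> \<ominus>\<^bsub>truncation n\<^esub> residue n x = residue n (- x)"
  using ring_hom_cring.hom_a_inv[OF residue_hom, of x n] O_uminus by simp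

lemma zero_O: "0 \<in> carrier \<O>" using O.zero_closed by (simp add: O_ops)

lemma uminus_O: "x \<in> carrier \<O> \<Longrightarrow> - x \<in> carrier \<O>"
  by (simp add: valuation_ring_def av_minus)

text \<open>
  Modulo \<open>\<PP>^n\<close>, every element of \<open>\<PP>^k\<close> is uniquely \<open>\<pi>^k t + y\<close> with \<open>t\<close> from a fixed set of representatives
  of the residue field and \<open>y\<close> from a fixed set of representatives of \<open>\<PP>^(k+1)/\<PP>^n\<close>; the functions \<open>\<rho>\<close> and \<open>\<sigma>\<close>
  in the proof choose these representatives.
\<close>

lemma card_residue_level_step:
  assumes k: "k < n"
  shows "card (residue n ` level k) = card (carrier (residue_field av)) * card (residue n ` level (Suc k))"
proof -
  have RF: "carrier (residue_field av) = residue 1 ` level 0"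
    unfolding valuation_ideal_level carrier_truncation carrier_O ..
  obtain \<rho> where \<rho>: "\<And>X. X \<in> residue 1 ` level 0 \<Longrightarrow> \<rho> X \<in> level 0 \<and> residue 1 (\<rho> X) = X"
    using bchoice[of "residue 1 ` level 0" "\<lambda>X x. x \<in> level 0 \<and> residue 1 x = X"] by blast
  obtain \<sigma> where \<sigma>: "\<And>Y. Y \<in> residue n ` level (Suc k) \<Longrightarrow> \<sigma> Y \<in> level (Suc k) \<and> residue n (\<sigma> Y) = Y"
    using bchoice[of "residue n ` level (Suc k)" "\<lambda>Y y. y \<in> level (Suc k) \<and> residue n y = Y"] by blast
  have pik: "\<pi> ^ k \<in> level k" by (simp add: level_def av_power)
  have lift: "\<pi> ^ k * t + y \<in> level k" if "t \<in> level 0" "y \<in> level (Suc k)" for t y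
    using mult_level[OF pik that(1)] that(2) level_antimono[of k "Suc k"]
    by (auto simp: level_def intro!: av_add_le)
  let ?h = "\<lambda>(X, Y). residue n (\<pi> ^ k * \<rho> X + \<sigma> Y)"
  have "bij_betw ?h ((residue 1 ` level 0) \<times> (residue n ` level (Suc k))) (residue n ` level k)"
  proof (rule bij_betw_imageI)
    show "inj_on ?h ((residue 1 ` level 0) \<times> (residue n ` level (Suc k)))"
    proof (rule inj_onI, clarify del: imageE)
      fix X Y X' Y'
      assume X: "X \<in> residue 1 ` level 0" "X' \<in> residue 1 ` level 0"
        and Y: "Y \<in> residue n ` level (Suc k)" "Y' \<in> residue n ` level (Suc k)"
        and eq: "residue n (\<pi> ^ k * \<rho> X + \<sigma> Y) = residue n (\<pi> ^ k * \<rho> X' + \<sigma> Y')"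
      note r = \<rho>[OF X(1)] \<rho>[OF X(2)] \<sigma>[OF Y(1)] \<sigma>[OF Y(2)]
      have diff: "\<pi> ^ k * (\<rho> X - \<rho> X') + (\<sigma> Y - \<sigma> Y') \<in> level n"
        using eq residue_eq_iff[of "\<pi> ^ k * \<rho> X + \<sigma> Y" "\<pi> ^ k * \<rho> X' + \<sigma> Y'" n]
          lift[of "\<rho> X" "\<sigma> Y"] lift[of "\<rho> X'" "\<sigma> Y'"] r level_O[of _ k]
        by (simp add: algebra_simps)
      then have "\<pi> ^ k * (\<rho> X - \<rho> X') + (\<sigma> Y - \<sigma> Y') \<in> level (Suc k)"
        using level_antimono[of "Suc k" n] k by auto
      moreover have "\<sigma> Y - \<sigma> Y' \<in> level (Suc k)" using r by (simp add: level_def av_diff_le)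
      ultimately have "\<pi> ^ k * (\<rho> X - \<rho> X') \<in> level (Suc k)"
        unfolding level_def mem_Collect_eq
        by (metis add_diff_cancel_right' av_diff_le)
      then have "\<rho> X - \<rho> X' \<in> level 1"
        using divide_pi_power[of "\<pi> ^ k * (\<rho> X - \<rho> X')" 1 k] pi_nonzero by simp
      then have "residue 1 (\<rho> X) = residue 1 (\<rho> X')"
        using residue_eq_iff[of "\<rho> X" "\<rho> X'" 1] r carrier_O by simp
      then have XX: "X = X'" using r by simp
      then have "\<sigma> Y - \<sigma> Y' \<in> level n" using diff by simp
      then have "residue n (\<sigma> Y) = residue n (\<sigma> Y')"
        using residue_eq_iff[of "\<sigma> Y" "\<sigma> Y'" n] r level_O by blast
      then show "X = X' \<and> Y = Y'" using r XX by simp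
    qed
    show "?h ` ((residue 1 ` level 0) \<times> (residue n ` level (Suc k))) = residue n ` level k"
    proof (intro equalityI subsetI)
      fix Z assume "Z \<in> ?h ` ((residue 1 ` level 0) \<times> (residue n ` level (Suc k)))"
      then obtain X Y where "X \<in> residue 1 ` level 0" "Y \<in> residue n ` level (Suc k)"
        and "Z = residue n (\<pi> ^ k * \<rho> X + \<sigma> Y)" by auto
      then show "Z \<in> residue n ` level k" using lift \<rho> \<sigma> by blast
    next
      fix Z assume "Z \<in> residue n ` level k"
      then obtain x where x: "x \<in> level k" and Z: "Z = residue n x" by blast
      define u where "u = x / \<pi> ^ k"
      have u: "u \<in> level 0" using divide_pi_power[of x 0 k] x by (simp add: u_def)
      define X where "X = residue 1 u"
      have X: "X \<in> residue 1 ` level 0" using u by (simp add: X_def)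
      have "u - \<rho> X \<in> level 1"
        using residue_eq_iff[of u "\<rho> X" 1] \<rho>[OF X] u carrier_O by (simp add: X_def)
      then have "\<pi> ^ k * (u - \<rho> X) \<in> level (Suc k)" using mult_level[OF pik] by fastforce
      then have y: "x - \<pi> ^ k * \<rho> X \<in> level (Suc k)" using pi_nonzero by (simp add: u_def algebra_simps)
      define Y where "Y = residue n (x - \<pi> ^ k * \<rho> X)"
      have Y: "Y \<in> residue n ` level (Suc k)" using y by (simp add: Y_def)
      have "(x - \<pi> ^ k * \<rho> X) - \<sigma> Y \<in> level n"
        using residue_eq_iff[OF level_O[OF y] level_O, of "\<sigma> Y" "Suc k" n] \<sigma>[OF Y] by (simp add: Y_def)
      then have "x - (\<pi> ^ k * \<rho> X + \<sigma> Y) \<in> level n" by (simp add: algebra_simps)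
      then have "Z = ?h (X, Y)"
        using residue_eq_iff[OF level_O[OF x] level_O[OF lift], of "\<rho> X" "\<sigma> Y" n]
          \<rho>[OF X] \<sigma>[OF Y] Z by simp
      then show "Z \<in> ?h ` ((residue 1 ` level 0) \<times> (residue n ` level (Suc k)))" using X Y by blast
    qed
  qed
  then show ?thesis unfolding RF using bij_betw_same_card card_cartesian_product by metis
qed

lemma residue_level_n: "residue n ` level n = {\<zero>\<^bsub>truncation n\<^esub>}"
proof -
  have "residue n x = residue n 0" if "x \<in> level n" for x
    using residue_eq_iff[of x 0 n] that level_O zero_O by simp
  then have "residue n ` level n = (\<lambda>_. residue n 0) ` level n" by (rule image_cong[OF refl])
  moreover have "0 \<in> level n" using pi_power_pos[of n] by (simp add: level_def av_zero less_imp_le)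
  ultimately show ?thesis by (simp only: residue_zero image_constant)
qed

lemma card_residue_level: "k \<le> n \<Longrightarrow> card (residue n ` level k) = card (carrier (residue_field av)) ^ (n - k)"
proof (induction rule: inc_induct)
  case base
  show ?case by (simp add: residue_level_n)
next
  case (step k)
  then have "n - k = Suc (n - Suc k)" by simp
  then show ?case by (simp only: card_residue_level_step[OF step.hyps(2)] step.IH power_Suc)
qed

text \<open>
  An element of valuation \<open>k\<close> is annihilated modulo \<open>\<PP>^n\<close> exactly by \<open>\<PP>^(n-k)\<close>, which has \<open>q^k\<close> residues.
\<close>

lemma finite_chain_ring_truncation:
  "finite_chain_ring (truncation n) (\<lambda>k. residue n ` level k) n (card (carrier (residue_field av)))"
proof (intro finite_chain_ring.intro cring_truncation finite_chain_ring_axioms.intro)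
  show "0 < card (carrier (residue_field av))"
    using finite_residue_field zero_O unfolding valuation_ideal_level carrier_truncation
    by (auto simp: card_gt_0_iff)
  show "residue n ` level 0 = carrier (truncation n)" by (simp add: carrier_truncation carrier_O)
  show "residue n ` level n = {\<zero>\<^bsub>truncation n\<^esub>}" by (rule residue_level_n)
  show "residue n ` level (Suc k) \<subseteq> residue n ` level k" for k
    by (intro image_mono level_antimono) simp
  show "card (residue n ` level k) = card (carrier (residue_field av)) ^ (n - k)" if "k \<le> n" for k
    by (rule card_residue_level[OF that])
next
  fix k a assume k: "k < n" and a: "a \<in> residue n ` level k - residue n ` level (Suc k)"
  then obtain x where x: "x \<in> level k" "x \<notin> level (Suc k)" and ax: "a = residue n x" by blast
  have avx: "av x = av \<pi> ^ k" by (rule av_eq_if_level[OF x])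
  have "0 < av x" unfolding avx by (rule pi_power_pos)
  then have x0: "x \<noteq> 0" using av_zero by auto
  have xO: "x \<in> carrier \<O>" using x level_O by blast
  show "\<exists>c\<in>carrier (truncation n). b = a \<otimes>\<^bsub>truncation n\<^esub> c" if b: "b \<in> residue n ` level k" for b
  proof -
    obtain y where y: "y \<in> level k" "b = residue n y" using b by blast
    have yx: "y / x \<in> carrier \<O>"
      using y pi_power_pos[of k] by (simp add: carrier_O level_def av_divide avx)
    have "b = a \<otimes>\<^bsub>truncation n\<^esub> residue n (y / x)"
      using residue_mult[OF xO yx] x0 y by (simp add: ax)
    then show ?thesis using yx carrier_truncation by auto
  qed
  have "residue n (x * y) = \<zero>\<^bsub>truncation n\<^esub> \<longleftrightarrow> y \<in> level (n - k)" if y: "y \<in> carrier \<O>" for y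
  proof -
    have "x * y \<in> carrier \<O>" using O.m_closed[OF xO y] by (simp add: O_ops)
    then have "residue n (x * y) = \<zero>\<^bsub>truncation n\<^esub> \<longleftrightarrow> x * y \<in> level n"
      unfolding residue_zero using residue_eq_iff[of "x * y" 0 n] zero_O by simp
    also have "\<dots> \<longleftrightarrow> av \<pi> ^ k * av y \<le> av \<pi> ^ k * av \<pi> ^ (n - k)"
      using k by (simp add: level_def multiplicative avx flip: power_add)
    also have "\<dots> \<longleftrightarrow> y \<in> level (n - k)" using pi_power_pos[of k] by (simp add: level_def)
    finally show ?thesis .
  qed
  then have "a \<otimes>\<^bsub>truncation n\<^esub> residue n y = \<zero>\<^bsub>truncation n\<^esub> \<longleftrightarrow> y \<in> level (n - k)"
    if "y \<in> carrier \<O>" for y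
    unfolding ax residue_mult[OF xO that] using that by blast
  then have "{b \<in> carrier (truncation n). a \<otimes>\<^bsub>truncation n\<^esub> b = \<zero>\<^bsub>truncation n\<^esub>}
      = residue n ` level (n - k)"
    unfolding carrier_truncation using level_O by blast
  then show "card {b \<in> carrier (truncation n). a \<otimes>\<^bsub>truncation n\<^esub> b = \<zero>\<^bsub>truncation n\<^esub>}
      = card (carrier (residue_field av)) ^ k"
    using card_residue_level[of "n - k" n] k by simp
qed

section \<open>Reductions of the two modules of matrices\<close>

lemma reduction_residue: "reduction av n M = map_mat (residue n) ` M"
  by (simp add: reduction_def ideal_power_level residue_def[abs_def])

lemma residue_section:
  "\<exists>\<rho>. \<forall>X\<in>carrier (truncation n). \<rho> X \<in> carrier \<O> \<and> residue n (\<rho> X) = X"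
  by (rule bchoice) (auto simp only: carrier_truncation)

lemma map_residue_matrices_over:
  assumes "A \<in> matrices_over \<O> d e"
  shows "map_mat (residue n) A \<in> matrices_over (truncation n) d e"
proof (rule matrices_overI)
  show "map_mat (residue n) A \<in> carrier_mat d e" using assms by (auto simp: matrices_over_def)
  fix i j assume ij: "i < d" "j < e"
  have "dim_row A = d" "dim_col A = e" using assms by (auto simp: matrices_over_def)
  then show "map_mat (residue n) A $$ (i, j) \<in> carrier (truncation n)"
    using matrices_over_entry[OF assms ij] ij by (simp add: carrier_truncation)
qed

lemma reduction_matrices_over:
  "reduction av n (matrices_over \<O> d e) = matrices_over (truncation n) d e"
proof (intro equalityI subsetI)
  fix A assume "A \<in> reduction av n (matrices_over \<O> d e)"
  then show "A \<in> matrices_over (truncation n) d e"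
    unfolding reduction_residue using map_residue_matrices_over by blast
next
  fix A assume A: "A \<in> matrices_over (truncation n) d e"
  then have dims: "dim_row A = d" "dim_col A = e" by (auto simp: matrices_over_def)
  obtain \<rho> where \<rho>: "\<And>X. X \<in> carrier (truncation n) \<Longrightarrow> \<rho> X \<in> carrier \<O> \<and> residue n (\<rho> X) = X"
    using residue_section[of n] by blast
  define B where "B = mat d e (\<lambda>(i,j). \<rho> (A $$ (i,j)))"
  have "B \<in> matrices_over \<O> d e"
    by (rule matrices_overI) (simp_all add: B_def \<rho> matrices_over_entry[OF A])
  moreover have "A = map_mat (residue n) B"
    by (rule eq_matI) (simp_all add: B_def dims \<rho> matrices_over_entry[OF A])
  ultimately show "A \<in> reduction av n (matrices_over \<O> d e)" unfolding reduction_residue by blast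
qed

lemma so_matrices_entries:
  assumes char: "CHAR('a) \<noteq> 2"
  shows "A \<in> so_matrices av d \<longleftrightarrow> A \<in> matrices_over \<O> d d \<and>
      (\<forall>i<d. A $$ (i,i) = 0) \<and> (\<forall>i<d. \<forall>j<d. A $$ (j,i) = - (A $$ (i,j)))"
proof (cases "A \<in> matrices_over \<O> d d")
  case True
  then have dims: "dim_row A = d" "dim_col A = d" by (auto simp: matrices_over_def)
  have "\<not> CHAR('a) dvd 2"
  proof
    assume "CHAR('a) dvd 2"
    then have "CHAR('a) = 1 \<or> CHAR('a) = 2" using two_is_prime_nat prime_nat_iff by blast
    then show False using char by simp
  qed
  then have two: "(2::'a) \<noteq> 0" using of_nat_eq_0_iff_char_dvd[where 'a = 'a and n = 2] by simp
  have "A + transpose_mat A = 0\<^sub>m d d \<longleftrightarrow> (\<forall>i<d. \<forall>j<d. A $$ (i,j) + A $$ (j,i) = 0)"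
    by (auto simp: mat_eq_iff dims)
  also have "\<dots> \<longleftrightarrow> (\<forall>i<d. \<forall>j<d. A $$ (j,i) = - (A $$ (i,j)))"
    by (simp add: add_eq_0_iff)
  finally have so: "A \<in> so_matrices av d \<longleftrightarrow> (\<forall>i<d. \<forall>j<d. A $$ (j,i) = - (A $$ (i,j)))"
    using True by (simp add: so_matrices_def)
  have "A $$ (i,i) = 0" if "A $$ (i,i) = - (A $$ (i,i))" for i
  proof -
    have "2 * A $$ (i,i) = A $$ (i,i) + A $$ (i,i)" by simp
    also have "\<dots> = 0" by (subst that) simp
    finally show ?thesis using two by simp
  qed
  then show ?thesis using True so by blast
next
  case False
  then show ?thesis by (simp add: so_matrices_def)
qed

text \<open>
  Surjectivity: lift the entries above the diagonal, negate them below it, and put \<open>0\<close> on the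
  diagonal.
\<close>

lemma reduction_so_matrices:
  assumes char: "CHAR('a) \<noteq> 2"
  shows "reduction av n (so_matrices av d) = alternating_matrices (truncation n) d"
proof (intro equalityI subsetI)
  fix A assume "A \<in> reduction av n (so_matrices av d)"
  then obtain B where B: "B \<in> so_matrices av d" and A: "A = map_mat (residue n) B"
    unfolding reduction_residue by blast
  have BM: "B \<in> matrices_over \<O> d d" and B0: "\<And>i. i < d \<Longrightarrow> B $$ (i,i) = 0"
    and B1: "\<And>i j. i < d \<Longrightarrow> j < d \<Longrightarrow> B $$ (j,i) = - (B $$ (i,j))"
    using B unfolding so_matrices_entries[OF char] by blast+
  have dims: "dim_row B = d" "dim_col B = d" using BM by (auto simp: matrices_over_def)
  have "A $$ (j,i) = \<ominus>\<^bsub>truncation n\<^esub> A $$ (i,j)" if ij: "i < d" "j < d" for i j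
  proof -
    have "A $$ (j,i) = residue n (- (B $$ (i,j)))" using ij by (simp add: A dims B1[OF ij])
    then show ?thesis using ij by (simp add: A dims residue_uminus[OF matrices_over_entry[OF BM ij]])
  qed
  moreover have "A $$ (i,i) = \<zero>\<^bsub>truncation n\<^esub>" if "i < d" for i
    using that by (simp add: A dims B0 residue_zero)
  ultimately show "A \<in> alternating_matrices (truncation n) d"
    using map_residue_matrices_over[OF BM] unfolding alternating_matrices_def A by blast
next
  fix A assume A: "A \<in> alternating_matrices (truncation n) d"
  then have AM: "A \<in> matrices_over (truncation n) d d"
    and A0: "\<And>i. i < d \<Longrightarrow> A $$ (i,i) = \<zero>\<^bsub>truncation n\<^esub>"
    and A1: "\<And>i j. i < d \<Longrightarrow> j < d \<Longrightarrow> A $$ (j,i) = \<ominus>\<^bsub>truncation n\<^esub> A $$ (i,j)"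
    unfolding alternating_matrices_def by blast+
  have dims: "dim_row A = d" "dim_col A = d" using AM by (auto simp: matrices_over_def)
  obtain \<rho> where "\<And>X. X \<in> carrier (truncation n) \<Longrightarrow> \<rho> X \<in> carrier \<O> \<and> residue n (\<rho> X) = X"
    using residue_section[of n] by blast
  then have \<rho>: "\<rho> (A $$ (i,j)) \<in> carrier \<O>" "residue n (\<rho> (A $$ (i,j))) = A $$ (i,j)"
    if "i < d" "j < d" for i j using matrices_over_entry[OF AM that] by blast+
  define b where "b = (\<lambda>i j. if i < j then \<rho> (A $$ (i,j)) else if j < i then - \<rho> (A $$ (j,i)) else 0)"
  have b: "b i j \<in> carrier \<O>" "residue n (b i j) = A $$ (i,j)" if ij: "i < d" "j < d" for i j
  proof -
    show "b i j \<in> carrier \<O>" using \<rho>(1) ij zero_O uminus_O by (simp add: b_def)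
    consider "i < j" | "j < i" | "i = j" by linarith
    then show "residue n (b i j) = A $$ (i,j)"
    proof cases
      case 1
      then show ?thesis using \<rho>(2)[OF ij] by (simp add: b_def)
    next
      case 2
      then show ?thesis
        using residue_uminus[OF \<rho>(1)[OF ij(2,1)], of n] \<rho>(2)[OF ij(2,1)] A1[OF ij(2,1)]
        by (simp add: b_def)
    next
      case 3
      then show ?thesis using A0[OF ij(1)] by (simp add: b_def residue_zero)
    qed
  qed
  define B where "B = mat d d (\<lambda>(i,j). b i j)"
  have "B \<in> matrices_over \<O> d d" by (rule matrices_overI) (simp_all add: B_def b)
  moreover have "B $$ (i,i) = 0" if "i < d" for i using that by (simp add: B_def b_def)
  moreover have "B $$ (j,i) = - (B $$ (i,j))" if "i < d" "j < d" for i j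
    using that by (simp add: B_def b_def)
  ultimately have "B \<in> so_matrices av d" unfolding so_matrices_entries[OF char] by blast
  moreover have "A = map_mat (residue n) B" by (rule eq_matI) (simp_all add: B_def dims b)
  ultimately show "A \<in> reduction av n (so_matrices av d)" unfolding reduction_residue by blast
qed

section \<open>The zeta functions\<close>

lemma ask_zeta_if_pivot_equidistributed:
  assumes "\<And>n. cring.pivot_equidistributed (truncation n) d (reduction av n M)"
    and M: "M \<subseteq> matrices_over \<O> d e" "M \<noteq> {}" and d: "d \<ge> 1"
    and q: "q = card (carrier (residue_field av))"
  shows "ask_zeta av M = Abs_fps (\<lambda>n. 1 + (\<Sum>m=1..n. of_nat q ^ m - of_nat q ^ m / of_nat q ^ d))"
proof -
  have "reduction av n M \<subseteq> matrices_over (truncation n) d e" for n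
    unfolding reduction_residue using map_residue_matrices_over M by blast
  moreover have "reduction av n M \<noteq> {}" for n unfolding reduction_residue using M by simp
  ultimately have "(\<Sum>A\<in>reduction av n M. of_nat (card (row_kernel (truncation n) A)))
        / (of_nat (card (reduction av n M)) :: rat)
      = 1 + (\<Sum>m=1..n. of_nat q ^ m - of_nat q ^ m / of_nat q ^ d)" for n
    unfolding q
    by (intro finite_chain_ring.average_kernel_size[OF finite_chain_ring_truncation assms(1) _ _ d])
  then show ?thesis unfolding ask_zeta_def ideal_power_level by (simp only:)
qed

lemma ask_zeta_matrices_over:
  assumes "d \<ge> 1" "q = card (carrier (residue_field av))"
  shows "ask_zeta av (matrices_over \<O> d (d - 1))
       = Abs_fps (\<lambda>n. 1 + (\<Sum>m=1..n. of_nat q ^ m - of_nat q ^ m / of_nat q ^ d))"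
proof (rule ask_zeta_if_pivot_equidistributed[OF _ subset_refl _ assms])
  show "cring.pivot_equidistributed (truncation n) d (reduction av n (matrices_over \<O> d (d - 1)))" for n
    unfolding reduction_matrices_over
    by (rule cring.pivot_equidistributed_all[OF cring_truncation
          finite_chain_ring.finite_carrier[OF finite_chain_ring_truncation]])
  have "0\<^sub>m d (d - 1) \<in> matrices_over \<O> d (d - 1)" by (rule matrices_overI) (simp_all add: zero_O)
  then show "matrices_over \<O> d (d - 1) \<noteq> {}" by blast
qed

lemma ask_zeta_so_matrices:
  assumes "d \<ge> 1" "q = card (carrier (residue_field av))" and char: "CHAR('a) \<noteq> 2"
  shows "ask_zeta av (so_matrices av d)
       = Abs_fps (\<lambda>n. 1 + (\<Sum>m=1..n. of_nat q ^ m - of_nat q ^ m / of_nat q ^ d))"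
proof (rule ask_zeta_if_pivot_equidistributed[OF _ _ _ assms(1,2)])
  show "cring.pivot_equidistributed (truncation n) d (reduction av n (so_matrices av d))" for n
    unfolding reduction_so_matrices[OF char]
    by (rule cring.pivot_equidistributed_alternating[OF cring_truncation
          finite_chain_ring.finite_carrier[OF finite_chain_ring_truncation]])
  show "so_matrices av d \<subseteq> matrices_over \<O> d d" unfolding so_matrices_def by blast
  have "0\<^sub>m d d \<in> matrices_over \<O> d d" by (rule matrices_overI) (simp_all add: zero_O)
  then have "0\<^sub>m d d \<in> so_matrices av d" by (simp add: so_matrices_entries[OF char])
  then show "so_matrices av d \<noteq> {}" by blast
qed

end

lemma (in nonarch_local_field) uniformizer_exists:
  obtains \<pi> where "uniformized_local_field av \<pi>"
proof -
  from discrete obtain c where c: "0 < c" "c < 1" and vals: "av ` (- {0}) = range (\<lambda>k::int. c powi k)"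
    by blast
  have "c powi 1 \<in> av ` (- {0})" unfolding vals by (rule rangeI)
  then obtain \<pi> where \<pi>: "av \<pi> = c" by auto
  have "\<exists>k::int. av x = av \<pi> powi k" if "x \<noteq> 0" for x
  proof -
    have "av x \<in> range (\<lambda>k::int. c powi k)" unfolding vals[symmetric] using that by simp
    then show ?thesis using \<pi> by auto
  qed
  then have "uniformized_local_field av \<pi>"
    by (intro uniformized_local_field.intro uniformized_local_field_axioms.intro nonarch_local_field_axioms)
      (use c \<pi> in auto)
  then show thesis by (rule that)
qed

text \<open>
  Multiplication by \<open>1 - T\<close> takes differences of the partial sums, leaving a geometric progression
  from the first term on, which multiplication by \<open>1 - q T\<close> collapses to a polynomial of
  degree at most one.
\<close>

lemma fps_geometric_quotient:
  fixes q :: rat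
  assumes q: "q \<noteq> 0"
  shows "Abs_fps (\<lambda>n. 1 + (\<Sum>m=1..n. q ^ m - q ^ m / q ^ d))
           = (1 - fps_const (q powi (1 - int d)) * fps_X)
             / ((1 - fps_X) * (1 - fps_const q * fps_X))"
proof -
  define h where "h = Abs_fps (\<lambda>n. 1 + (\<Sum>m=1..n. q ^ m - q ^ m / q ^ d))"
  define g where "g = Abs_fps (\<lambda>n. if n = 0 then 1 else q ^ n - q ^ n / q ^ d)"
  define f where "f = 1 - fps_const (q powi (1 - int d)) * fps_X"
  define w where "w = (1 - fps_X) * (1 - fps_const q * fps_X)"
  have hg: "h * (1 - fps_X) = g"
  proof (rule fps_ext)
    fix n
    have "h * (1 - fps_X) = h - h * fps_X" by (simp add: right_diff_distrib)
    then show "fps_nth (h * (1 - fps_X)) n = fps_nth g n"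
      by (cases n) (simp_all add: h_def g_def)
  qed
  have gf: "g * (1 - fps_const q * fps_X) = f"
  proof (rule fps_ext)
    fix n
    have pow: "q powi (1 - int d) = q / q ^ d" using q by (simp add: power_int_diff)
    have "g * (1 - fps_const q * fps_X) = g - fps_const q * (g * fps_X)"
      by (simp add: right_diff_distrib mult.left_commute)
    then have "fps_nth (g * (1 - fps_const q * fps_X)) n
        = fps_nth g n - q * (if n = 0 then 0 else fps_nth g (n - 1))"
      by simp
    also have "\<dots> = fps_nth f n"
    proof -
      consider "n = 0" | "n = 1" | m where "n = Suc (Suc m)" by (metis One_nat_def old.nat.exhaust)
      then show ?thesis
        by cases (simp_all add: f_def g_def pow right_diff_distrib)
    qed
    finally show "fps_nth (g * (1 - fps_const q * fps_X)) n = fps_nth f n" .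
  qed
  have "fps_nth w 0 = 1" by (simp add: w_def)
  then have "w \<noteq> 0" by auto
  moreover have "h * w = f" unfolding w_def using hg gf by (simp add: mult.assoc[symmetric])
  ultimately have "h = f / w" using nonzero_mult_div_cancel_right[of w h] by simp
  then show ?thesis unfolding h_def f_def w_def .
qed

theorem proposition5p11:
  fixes av :: "'a::field \<Rightarrow> real" and d q :: nat
  assumes "nonarch_local_field av"
    and "CHAR('a) \<noteq> 2"
    and "q = card (carrier (residue_field av))"
    and "d \<ge> 1"
  shows "ask_zeta av (so_matrices av d)
           = ask_zeta av (matrices_over (valuation_ring av) d (d - 1))
       \<and> ask_zeta av (matrices_over (valuation_ring av) d (d - 1))
           = (1 - fps_const (of_nat q powi (1 - int d)) * fps_X)
             / ((1 - fps_X) * (1 - fps_const (of_nat q) * fps_X))"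
proof -
  obtain \<pi> where "uniformized_local_field av \<pi>"
    using nonarch_local_field.uniformizer_exists[OF assms(1)] .
  then interpret uniformized_local_field av \<pi> .
  have "q > 0" unfolding assms(3)
    using finite_chain_ring.q_pos[OF finite_chain_ring_truncation] .
  then have "(of_nat q :: rat) \<noteq> 0" by simp
  then show ?thesis
    unfolding ask_zeta_so_matrices[OF assms(4,3,2)] ask_zeta_matrices_over[OF assms(4,3)]
    by (intro conjI refl fps_geometric_quotient)
qed

end
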